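(* Let $X,Y$ be metric spaces, let $x_0\in X$ and let $p=d(x_0,\cdot):X\to\mathbb{R}_{\ge0}$. Let $\alpha,\beta:X\to Y$ be coarse maps. Then the following are equivalent: (a) $\alpha$ and $\beta$ are coarsely homotopic, i.e. there is a coarse map $h:X\ast I\to Y$ with $h\circ\iota_0$ close to $\alpha$ and $h\circ\iota_1$ close to $\beta$; (b) $\alpha$ and $\beta$ are $p$-coarsely homotopic, i.e. there is a coarse map $h:I_pX\to Y$ with $h\circ i_0=\alpha$ and $h\circ i_1=\beta$.
   Context: Metrics take only finite values. A subset $E\subseteq X\times X$ of the square of a metric space is an entourage if $\sup_{(x,y)\in E}d(x,y)<\infty$. A map $f:X\to Y$ between metric spaces is coarse if $(f\times f)(E)$ is an entourage for every entourage $E$ and $f^{-1}(B)$ is bounded for every bounded $B\subseteq Y$. Maps $f,g:X\to Y$ are close if $\sup_{x} d(f(x),g(x))<\infty$. Products of metric spaces carry the maximum metric unless stated otherwise. Let $I=\mathbb{R}_{\ge0}\times\mathbb{R}_{\ge0}$ with the metric $d((s_0,t_0),(s_1,t_1))=|s_0-s_1|+|t_0-t_1|$. Put $X\ast I=\{(x,(s,t))\in X\times I: d(x,x_0)=s+t\}$ with the metric restricted from the maximum metric on $X\times I$, and $\iota_0,\iota_1:X\to X\ast I$, $\iota_0(x)=(x,(d(x,x_0),0))$, $\iota_1(x)=(x,(0,d(x,x_0)))$. Put $I_pX=\{(x,t)\in X\times\mathbb{R}_{\ge0}: t\le p(x)+1\}$ with the metric restricted from $X\times\mathbb{R}_{\ge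 0}$, and $i_0,i_1:X\to I_pX$, $i_0(x)=(x,0)$, $i_1(x)=(x,p(x)+1)$. *)

theory Defs
  imports "HOL-Analysis.Abstract_Metric_Spaces"
begin

text \<open>
  Metric spaces are elements of the type of abstract metrics, with an explicit carrier
  \<open>mspace X\<close>. A map between them is a HOL function of which only the restriction to the
  carrier matters.
\<close>

subsection \<open>Coarse maps\<close>

definition entourage :: "'a metric \<Rightarrow> ('a \<times> 'a) set \<Rightarrow> bool" where
  "entourage X E \<longleftrightarrow>
     E \<subseteq> mspace X \<times> mspace X \<and> bdd_above ((\<lambda>(x, y). mdist X x y) ` E)"

definition bounded_subset :: "'a metric \<Rightarrow> 'a set \<Rightarrow> bool" where
  "bounded_subset X B \<longleftrightarrow> Metric_space.mbounded (mspace X) (mdist X) B"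

definition coarse_map :: "'a metric \<Rightarrow> 'b metric \<Rightarrow> ('a \<Rightarrow> 'b) \<Rightarrow> bool" where
  "coarse_map X Y f \<longleftrightarrow>
     f \<in> mspace X \<rightarrow> mspace Y \<and>
     (\<forall>E. entourage X E \<longrightarrow> entourage Y (map_prod f f ` E)) \<and>
     (\<forall>B. bounded_subset Y B \<longrightarrow> bounded_subset X (f -` B \<inter> mspace X))"

definition close_maps :: "'a metric \<Rightarrow> 'b metric \<Rightarrow> ('a \<Rightarrow> 'b) \<Rightarrow> ('a \<Rightarrow> 'b) \<Rightarrow> bool" where
  "close_maps X Y f g \<longleftrightarrow> bdd_above ((\<lambda>x. mdist Y (f x) (g x)) ` mspace X)"

subsection \<open>Products with the maximum metric\<close>

text \<open>The library's \<open>prod_metric\<close> is the Euclidean product, hence a separate definition.\<close>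

definition max_prod_metric :: "'a metric \<Rightarrow> 'b metric \<Rightarrow> ('a \<times> 'b) metric" where
  "max_prod_metric X Y =
     metric (mspace X \<times> mspace Y,
             \<lambda>(x, y) (x', y'). max (mdist X x x') (mdist Y y y'))"

lemma Metric_space_max_prod:
  "Metric_space (mspace X \<times> mspace Y)
     (\<lambda>(x, y) (x', y'). max (mdist X x x') (mdist Y y y'))"
proof -
  have "max (mdist X x x') (mdist Y y y') = 0 \<longleftrightarrow> x = x' \<and> y = y'"
    if "x \<in> mspace X" "x' \<in> mspace X" "y \<in> mspace Y" "y' \<in> mspace Y" for x x' y y'
    using that mdist_nonneg[of X x x'] mdist_nonneg[of Y y y']
      mdist_zero[of x X x'] mdist_zero[of y Y y']
    by linarith
  moreover have "max (mdist X x x'') (mdist Y y y'')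
      \<le> max (mdist X x x') (mdist Y y y') + max (mdist X x' x'') (mdist Y y' y'')"
    if "x \<in> mspace X" "x' \<in> mspace X" "x'' \<in> mspace X"
      "y \<in> mspace Y" "y' \<in> mspace Y" "y'' \<in> mspace Y" for x x' x'' y y' y''
    using that mdist_triangle[of x X x' x''] mdist_triangle[of y Y y' y''] by linarith
  ultimately show ?thesis
    by unfold_locales (auto simp: mdist_commute le_max_iff_disj)
qed

lemma mspace_max_prod_metric [simp]:
  "mspace (max_prod_metric X Y) = mspace X \<times> mspace Y"
  by (simp add: max_prod_metric_def Metric_space.mspace_metric[OF Metric_space_max_prod])

lemma mdist_max_prod_metric [simp]:
  "mdist (max_prod_metric X Y) (x, y) (x', y') = max (mdist X x x') (mdist Y y y')"
  by (simp add: max_prod_metric_def Metric_space.mdist_metric[OF Metric_space_max_prod])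

subsection \<open>The two cylinders\<close>

definition half_line :: "real metric" where
  "half_line = submetric euclidean_metric {0..}"

definition quadrant :: "(real \<times> real) metric" where
  "quadrant = metric ({0..} \<times> {0..}, \<lambda>(s0, t0) (s1, t1). \<bar>s0 - s1\<bar> + \<bar>t0 - t1\<bar>)"

lemma Metric_space_quadrant:
  "Metric_space ({0..} \<times> {0..})
     (\<lambda>(s0::real, t0::real) (s1, t1). \<bar>s0 - s1\<bar> + \<bar>t0 - t1\<bar>)"
  by unfold_locales (auto split: prod.splits)

lemma mspace_quadrant [simp]: "mspace quadrant = {0..} \<times> {0..}"
  by (simp add: quadrant_def Metric_space.mspace_metric[OF Metric_space_quadrant])

lemma mdist_quadrant [simp]:
  "mdist quadrant (s0, t0) (s1, t1) = \<bar>s0 - s1\<bar> + \<bar>t0 - t1\<bar>"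
  by (simp add: quadrant_def Metric_space.mdist_metric[OF Metric_space_quadrant])

text \<open>
  \<open>asterisk X x0\<close> is \<open>X * I\<close> with base point \<open>x0\<close>, and \<open>p_cylinder X p\<close> is \<open>I_p X\<close>;
  nonnegativity of the real coordinates comes from the carriers of \<open>quadrant\<close> and
  \<open>half_line\<close>.
\<close>

definition asterisk :: "'a metric \<Rightarrow> 'a \<Rightarrow> ('a \<times> real \<times> real) metric" where
  "asterisk X x0 =
     submetric (max_prod_metric X quadrant) {(x, (s, t)). mdist X x x0 = s + t}"

definition asterisk_incl0 :: "'a metric \<Rightarrow> 'a \<Rightarrow> 'a \<Rightarrow> 'a \<times> real \<times> real" where
  "asterisk_incl0 X x0 x = (x, (mdist X x x0, 0))"

definition asterisk_incl1 :: "'a metric \<Rightarrow> 'a \<Rightarrow> 'a \<Rightarrow> 'a \<times> real \<times> real" where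
  "asterisk_incl1 X x0 x = (x, (0, mdist X x x0))"

definition p_cylinder :: "'a metric \<Rightarrow> ('a \<Rightarrow> real) \<Rightarrow> ('a \<times> real) metric" where
  "p_cylinder X p = submetric (max_prod_metric X half_line) {(x, t). t \<le> p x + 1}"

definition p_cylinder_incl0 :: "'a \<Rightarrow> 'a \<times> real" where
  "p_cylinder_incl0 x = (x, 0)"

definition p_cylinder_incl1 :: "('a \<Rightarrow> real) \<Rightarrow> 'a \<Rightarrow> 'a \<times> real" where
  "p_cylinder_incl1 p x = (x, p x + 1)"

subsection \<open>Homotopy\<close>

definition coarsely_homotopic ::
  "'a metric \<Rightarrow> 'b metric \<Rightarrow> 'a \<Rightarrow> ('a \<Rightarrow> 'b) \<Rightarrow> ('a \<Rightarrow> 'b) \<Rightarrow> bool" where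
  "coarsely_homotopic X Y x0 \<alpha> \<beta> \<longleftrightarrow>
     (\<exists>h. coarse_map (asterisk X x0) Y h \<and>
          close_maps X Y (h \<circ> asterisk_incl0 X x0) \<alpha> \<and>
          close_maps X Y (h \<circ> asterisk_incl1 X x0) \<beta>)"

definition p_coarsely_homotopic ::
  "'a metric \<Rightarrow> 'b metric \<Rightarrow> ('a \<Rightarrow> real) \<Rightarrow> ('a \<Rightarrow> 'b) \<Rightarrow> ('a \<Rightarrow> 'b) \<Rightarrow> bool" where
  "p_coarsely_homotopic X Y p \<alpha> \<beta> \<longleftrightarrow>
     (\<exists>h. coarse_map (p_cylinder X p) Y h \<and>
          (\<forall>x \<in> mspace X. (h \<circ> p_cylinder_incl0) x = \<alpha> x) \<and>
          (\<forall>x \<in> mspace X. (h \<circ> p_cylinder_incl1 p) x = \<beta> x))"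

end

theory Submission
  imports Defs
begin

text \<open>
  Put \<open>p x = d(x0, x)\<close>. The two cylinders are quasi-isometric.
  A point \<open>(x, (s, t))\<close> of \<open>X * I\<close> has \<open>s = p x - t\<close>, so it is determined by
  \<open>x\<close> and \<open>t \<le> p x\<close>; forgetting \<open>s\<close> embeds \<open>X * I\<close> into \<open>I_p X\<close>. Since
  \<open>p\<close> is 1-Lipschitz, this loses only a factor \<open>3\<close> in distances. In the other direction, a
  point \<open>(x, t)\<close> of \<open>I_p X\<close> with \<open>t \<le> p x + 1\<close> is moved by at most \<open>1\<close> when \<open>t\<close> is
  cut off at \<open>p x\<close>, after which \<open>s\<close> can be restored. Both maps are therefore coarse
  (\<open>coarse_map_if_quasi_isometric_embedding\<close>), and composition with them turns a homotopy of
  one kind into a homotopy of the other kind, up to the values at the two ends.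

  At the ends the values match up to bounded error only. For a homotopy on \<open>X * I\<close> this is
  enough, because only closeness is asked for, and \<open>t = p x\<close> is at distance \<open>1\<close> from
  \<open>t = p x + 1\<close>. On \<open>I_p X\<close> exact end values are required, and the composite is overwritten by \<open>\<alpha>\<close> at \<open>t = 0\<close> and by \<open>\<beta>\<close> at \<open>t = p x + 1\<close>. The two ends are
  disjoint because of the summand \<open>1\<close>, and the new map is close to the old one, hence coarse
  (\<open>coarse_map_if_close\<close>).
\<close>

section \<open>Coarse maps and closeness\<close>

lemma mdist_self: "x \<in> mspace X \<Longrightarrow> mdist X x x = 0"
  by simp

lemma bounded_subset_iff:
  "bounded_subset X B \<longleftrightarrow> B \<subseteq> mspace X \<and> (\<exists>R. \<forall>x\<in>B. \<forall>y\<in>B. mdist X x y \<le> R)"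
  unfolding bounded_subset_def Metric_space.mbounded_alt[OF Metric_space_mspace_mdist] ..

lemma entourage_iff:
  "entourage X E \<longleftrightarrow> E \<subseteq> mspace X \<times> mspace X \<and> (\<exists>R. \<forall>(x, y)\<in>E. mdist X x y \<le> R)"
  unfolding entourage_def bdd_above_def by fastforce

lemma close_maps_iff: "close_maps X Y f g \<longleftrightarrow> (\<exists>R. \<forall>x\<in>mspace X. mdist Y (f x) (g x) \<le> R)"
  unfolding close_maps_def bdd_above_def by auto

lemma coarse_map_iff:
  "coarse_map X Y f \<longleftrightarrow>
     f \<in> mspace X \<rightarrow> mspace Y \<and>
     (\<forall>R. \<exists>S. \<forall>x\<in>mspace X. \<forall>y\<in>mspace X. mdist X x y \<le> R \<longrightarrow> mdist Y (f x) (f y) \<le> S) \<and>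
     (\<forall>B. bounded_subset Y B \<longrightarrow> bounded_subset X (f -` B \<inter> mspace X))"
proof -
  have "(\<forall>E. entourage X E \<longrightarrow> entourage Y (map_prod f f ` E)) \<longleftrightarrow>
     (\<forall>R. \<exists>S. \<forall>x\<in>mspace X. \<forall>y\<in>mspace X. mdist X x y \<le> R \<longrightarrow> mdist Y (f x) (f y) \<le> S)"
    (is "?entourages \<longleftrightarrow> ?controlled") if f: "f \<in> mspace X \<rightarrow> mspace Y"
  proof
    assume L: ?entourages
    show ?controlled
    proof
      fix R
      let ?E = "{(x, y) \<in> mspace X \<times> mspace X. mdist X x y \<le> R}"
      have "entourage X ?E"
        by (auto simp: entourage_iff)
      with L have "entourage Y (map_prod f f ` ?E)"
        by blast
      then show "\<exists>S. \<forall>x\<in>mspace X. \<forall>y\<in>mspace X. mdist X x y \<le> R \<longrightarrow> mdist Y (f x) (f y) \<le> S"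
        by (fastforce simp: entourage_iff)
    qed
  next
    assume R: ?controlled
    show ?entourages
    proof (intro allI impI)
      fix E assume E: "entourage X E"
      then obtain R where "\<forall>(x, y)\<in>E. mdist X x y \<le> R"
        by (auto simp: entourage_iff)
      moreover obtain S where
        "\<forall>x\<in>mspace X. \<forall>y\<in>mspace X. mdist X x y \<le> R \<longrightarrow> mdist Y (f x) (f y) \<le> S"
        using R by blast
      ultimately have "\<forall>(x, y)\<in>map_prod f f ` E. mdist Y x y \<le> S"
        using E by (fastforce simp: entourage_iff)
      moreover have "map_prod f f ` E \<subseteq> mspace Y \<times> mspace Y"
        using E f by (fastforce simp: entourage_iff)
      ultimately show "entourage Y (map_prod f f ` E)"
        unfolding entourage_iff by blast
    qed
  qed
  then show ?thesis
    unfolding coarse_map_def by blast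
qed

lemma coarse_map_compose:
  assumes f: "coarse_map X Y f" and g: "coarse_map Y Z g"
  shows "coarse_map X Z (g \<circ> f)"
proof -
  have maps: "f \<in> mspace X \<rightarrow> mspace Y" "g \<in> mspace Y \<rightarrow> mspace Z"
    using f g by (auto simp: coarse_map_def)
  have "entourage Z (map_prod (g \<circ> f) (g \<circ> f) ` E)" if "entourage X E" for E
    using that f g unfolding coarse_map_def by (metis image_comp map_prod.comp)
  moreover have "bounded_subset X ((g \<circ> f) -` B \<inter> mspace X)" if "bounded_subset Z B" for B
  proof -
    have "(g \<circ> f) -` B \<inter> mspace X = f -` (g -` B \<inter> mspace Y) \<inter> mspace X"
      using maps by auto
    then show ?thesis
      using that f g unfolding coarse_map_def by metis
  qed
  ultimately show ?thesis
    using maps by (auto simp: coarse_map_def)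
qed

lemma close_maps_compose_coarse:
  assumes g: "coarse_map Y Z g" and close: "close_maps X Y a b"
    and a: "a \<in> mspace X \<rightarrow> mspace Y" and b: "b \<in> mspace X \<rightarrow> mspace Y"
  shows "close_maps X Z (g \<circ> a) (g \<circ> b)"
proof -
  obtain R where "\<forall>x\<in>mspace X. mdist Y (a x) (b x) \<le> R"
    using close by (auto simp: close_maps_iff)
  moreover obtain S where
    "\<forall>u\<in>mspace Y. \<forall>v\<in>mspace Y. mdist Y u v \<le> R \<longrightarrow> mdist Z (g u) (g v) \<le> S"
    using g unfolding coarse_map_iff by blast
  ultimately show ?thesis
    using a b unfolding close_maps_iff by (intro exI[of _ S]) (auto simp: Pi_iff)
qed

text \<open>
  Distances between values change by at most twice the closeness bound when \<open>f\<close> is replaced by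
  \<open>g\<close>. This gives control, and it shows that the \<open>f\<close>-image of the \<open>g\<close>-preimage of a bounded set
  is again bounded, which reduces properness of \<open>g\<close> to that of \<open>f\<close>.
\<close>

lemma coarse_map_if_close:
  assumes f: "coarse_map X Y f" and close: "close_maps X Y f g"
    and g: "g \<in> mspace X \<rightarrow> mspace Y"
  shows "coarse_map X Y g"
proof -
  have fY: "f \<in> mspace X \<rightarrow> mspace Y"
    using f by (simp add: coarse_map_def)
  obtain K where K: "\<And>x. x \<in> mspace X \<Longrightarrow> mdist Y (f x) (g x) \<le> K"
    using close by (auto simp: close_maps_iff)
  have dist_fg: "mdist Y (g x) (g y) \<le> mdist Y (f x) (f y) + 2 * K"
    "mdist Y (f x) (f y) \<le> mdist Y (g x) (g y) + 2 * K"
    if x: "x \<in> mspace X" and y: "y \<in> mspace X" for x y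
  proof -
    have "f x \<in> mspace Y" "g x \<in> mspace Y" "f y \<in> mspace Y" "g y \<in> mspace Y"
      using x y fY g by auto
    then show "mdist Y (g x) (g y) \<le> mdist Y (f x) (f y) + 2 * K"
      "mdist Y (f x) (f y) \<le> mdist Y (g x) (g y) + 2 * K"
      using K[OF x] K[OF y] mdist_triangle[of "g x" Y "f x" "g y"]
        mdist_triangle[of "f x" Y "f y" "g y"] mdist_triangle[of "f x" Y "g x" "f y"]
        mdist_triangle[of "g x" Y "g y" "f y"]
      by (auto simp: mdist_commute[of Y "g x" "f x"] mdist_commute[of Y "g y" "f y"])
  qed
  have "\<exists>S. \<forall>x\<in>mspace X. \<forall>y\<in>mspace X. mdist X x y \<le> R \<longrightarrow> mdist Y (g x) (g y) \<le> S" for R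
  proof -
    obtain S where "\<forall>x\<in>mspace X. \<forall>y\<in>mspace X. mdist X x y \<le> R \<longrightarrow> mdist Y (f x) (f y) \<le> S"
      using f unfolding coarse_map_iff by blast
    then show ?thesis
      using dist_fg(1) by (intro exI[of _ "S + 2 * K"]) fastforce
  qed
  moreover have "bounded_subset X (g -` B \<inter> mspace X)" if B: "bounded_subset Y B" for B
  proof -
    let ?P = "g -` B \<inter> mspace X"
    obtain R where R: "\<forall>x\<in>B. \<forall>y\<in>B. mdist Y x y \<le> R"
      using B by (auto simp: bounded_subset_iff)
    have "mdist Y (f x) (f y) \<le> R + 2 * K" if "x \<in> ?P" "y \<in> ?P" for x y
      using that R dist_fg(2)[of x y] by fastforce
    then have "bounded_subset Y (f ` ?P)"
      using fY unfolding bounded_subset_iff by blast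
    then have "bounded_subset X (f -` f ` ?P \<inter> mspace X)"
      using f by (simp add: coarse_map_def)
    moreover have "?P \<subseteq> f -` f ` ?P \<inter> mspace X"
      by auto
    ultimately show ?thesis
      unfolding bounded_subset_iff by (meson order_trans subsetD)
  qed
  ultimately show ?thesis
    using g by (simp add: coarse_map_iff)
qed

text \<open>The upper bound gives control; the lower bound makes preimages of bounded sets bounded.\<close>

lemma coarse_map_if_quasi_isometric_embedding:
  assumes f: "f \<in> mspace X \<rightarrow> mspace Y" and A: "0 \<le> A"
    and upper: "\<And>x y. x \<in> mspace X \<Longrightarrow> y \<in> mspace X \<Longrightarrow>
      mdist Y (f x) (f y) \<le> A * mdist X x y + B"
    and lower: "\<And>x y. x \<in> mspace X \<Longrightarrow> y \<in> mspace X \<Longrightarrow>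
      mdist X x y \<le> A * mdist Y (f x) (f y) + B"
  shows "coarse_map X Y f"
proof -
  have "\<exists>S. \<forall>x\<in>mspace X. \<forall>y\<in>mspace X. mdist X x y \<le> R \<longrightarrow> mdist Y (f x) (f y) \<le> S" for R
  proof (intro exI ballI impI)
    fix x y assume "x \<in> mspace X" "y \<in> mspace X" "mdist X x y \<le> R"
    then show "mdist Y (f x) (f y) \<le> A * R + B"
      using upper[of x y] mult_left_mono[of "mdist X x y" R A] A by linarith
  qed
  moreover have "bounded_subset X (f -` C \<inter> mspace X)" if C: "bounded_subset Y C" for C
  proof -
    obtain R where R: "\<And>u v. u \<in> C \<Longrightarrow> v \<in> C \<Longrightarrow> mdist Y u v \<le> R"
      using C by (auto simp: bounded_subset_iff)
    have "mdist X x y \<le> A * R + B" if "x \<in> f -` C \<inter> mspace X" "y \<in> f -` C \<inter> mspace X" for x y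
      using that lower[of x y] mult_left_mono[OF R[of "f x" "f y"] A] by auto
    then show ?thesis
      unfolding bounded_subset_iff by blast
  qed
  ultimately show ?thesis
    using f by (simp add: coarse_map_iff)
qed

section \<open>Quasi-isometric embeddings between the cylinders\<close>

lemma mspace_asterisk:
  "mspace (asterisk X x0) = {(x, (s, t)). x \<in> mspace X \<and> 0 \<le> s \<and> 0 \<le> t \<and> mdist X x x0 = s + t}"
  by (auto simp: asterisk_def)

lemma mdist_asterisk:
  "mdist (asterisk X x0) (x, (s, t)) (x', (s', t')) =
     max (mdist X x x') (\<bar>s - s'\<bar> + \<bar>t - t'\<bar>)"
  by (simp add: asterisk_def)

lemma mspace_p_cylinder:
  "mspace (p_cylinder X p) = {(x, t). x \<in> mspace X \<and> 0 \<le> t \<and> t \<le> p x + 1}"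
  by (auto simp: p_cylinder_def half_line_def)

lemma mdist_p_cylinder:
  "mdist (p_cylinder X p) (x, t) (x', t') = max (mdist X x x') \<bar>t - t'\<bar>"
  by (simp add: p_cylinder_def half_line_def dist_real_def)

lemma mdist_basepoint_Lipschitz:
  assumes "x0 \<in> mspace X" "x \<in> mspace X" "y \<in> mspace X"
  shows "\<bar>mdist X x0 x - mdist X x0 y\<bar> \<le> mdist X x y"
  using assms mdist_triangle[of x0 X x y] mdist_triangle[of x0 X y x]
  by (simp add: mdist_commute[of X y x])

definition asterisk_to_cylinder :: "'a \<times> real \<times> real \<Rightarrow> 'a \<times> real" where
  "asterisk_to_cylinder = (\<lambda>(x, (s, t)). (x, t))"

definition cylinder_to_asterisk :: "('a \<Rightarrow> real) \<Rightarrow> 'a \<times> real \<Rightarrow> 'a \<times> real \<times> real" where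
  "cylinder_to_asterisk p = (\<lambda>(x, t). (x, (p x - min t (p x), min t (p x))))"

lemma max_le_three_times_max:
  fixes a b :: real
  assumes "0 \<le> a"
  shows "max a b \<le> 3 * max a b"
  using mult_right_mono[of 1 3 "max a b"] assms by (simp add: le_max_iff_disj)

lemma coarse_asterisk_to_cylinder:
  assumes x0: "x0 \<in> mspace X"
  shows "coarse_map (asterisk X x0) (p_cylinder X (mdist X x0)) asterisk_to_cylinder"
proof (rule coarse_map_if_quasi_isometric_embedding[where A = 3 and B = 0])
  fix u v assume u: "u \<in> mspace (asterisk X x0)" and v: "v \<in> mspace (asterisk X x0)"
  obtain x s t y s' t' where uv: "u = (x, (s, t))" "v = (y, (s', t'))"
    by (metis surj_pair)
  let ?D = "mdist X x y"
  \<comment> \<open>As \<open>s = p x - t\<close>, the Lipschitz bound for \<open>p\<close> controls the forgotten coordinate.\<close>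
  have "\<bar>(s + t) - (s' + t')\<bar> \<le> ?D"
    using u v mdist_basepoint_Lipschitz[OF x0, of x y]
    by (simp add: uv mspace_asterisk mdist_commute[of X x0])
  then have s: "\<bar>s - s'\<bar> \<le> ?D + \<bar>t - t'\<bar>"
    by linarith
  have D: "0 \<le> ?D"
    by simp
  have "max ?D \<bar>t - t'\<bar> \<le> max ?D (\<bar>s - s'\<bar> + \<bar>t - t'\<bar>)"
    by (rule max.mono) auto
  also have "\<dots> \<le> 3 * max ?D (\<bar>s - s'\<bar> + \<bar>t - t'\<bar>)"
    by (rule max_le_three_times_max[OF D])
  finally show
    "mdist (p_cylinder X (mdist X x0)) (asterisk_to_cylinder u) (asterisk_to_cylinder v)
      \<le> 3 * mdist (asterisk X x0) u v + 0"
    by (simp add: uv asterisk_to_cylinder_def mdist_asterisk mdist_p_cylinder)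
  have "max ?D (\<bar>s - s'\<bar> + \<bar>t - t'\<bar>) \<le> ?D + 2 * \<bar>t - t'\<bar>"
    using s by (intro max.boundedI) simp_all
  also have "\<dots> \<le> 3 * max ?D \<bar>t - t'\<bar>"
    by (simp add: max_def)
  finally show
    "mdist (asterisk X x0) u v
      \<le> 3 * mdist (p_cylinder X (mdist X x0)) (asterisk_to_cylinder u) (asterisk_to_cylinder v) + 0"
    by (simp add: uv asterisk_to_cylinder_def mdist_asterisk mdist_p_cylinder)
qed (auto simp: asterisk_to_cylinder_def mspace_asterisk mspace_p_cylinder mdist_commute[of X x0])

lemma coarse_cylinder_to_asterisk:
  assumes x0: "x0 \<in> mspace X"
  shows "coarse_map (p_cylinder X (mdist X x0)) (asterisk X x0)
           (cylinder_to_asterisk (mdist X x0))"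
proof (rule coarse_map_if_quasi_isometric_embedding[where A = 3 and B = 1])
  let ?p = "mdist X x0"
  fix u v assume u: "u \<in> mspace (p_cylinder X ?p)" and v: "v \<in> mspace (p_cylinder X ?p)"
  obtain x t y t' where uv: "u = (x, t)" "v = (y, t')"
    by (metis surj_pair)
  let ?D = "mdist X x y"
  define m m' where "m = min t (?p x)" and "m' = min t' (?p y)"
  have D: "0 \<le> ?D"
    by simp
  have lip: "\<bar>?p x - ?p y\<bar> \<le> ?D"
    using u v mdist_basepoint_Lipschitz[OF x0, of x y] by (simp add: uv mspace_p_cylinder)
  have m: "\<bar>m - m'\<bar> \<le> max ?D \<bar>t - t'\<bar>"
    using lip by (auto simp: m_def m'_def min_def max_def)
  have "\<bar>(?p x - m) - (?p y - m')\<bar> \<le> \<bar>?p x - ?p y\<bar> + \<bar>m - m'\<bar>"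
    by linarith
  then have "\<bar>(?p x - m) - (?p y - m')\<bar> + \<bar>m - m'\<bar> \<le> ?D + 2 * \<bar>m - m'\<bar>"
    using lip by simp
  also have "\<dots> \<le> 3 * max ?D \<bar>t - t'\<bar>"
    using m by (cases "?D \<le> \<bar>t - t'\<bar>") (simp_all add: max_def)
  finally have "\<bar>(?p x - m) - (?p y - m')\<bar> + \<bar>m - m'\<bar> \<le> 3 * max ?D \<bar>t - t'\<bar>" .
  moreover have "?D \<le> 3 * max ?D \<bar>t - t'\<bar>"
    using max_le_three_times_max[OF D] max.cobounded1 order_trans by blast
  ultimately have "max ?D (\<bar>(?p x - m) - (?p y - m')\<bar> + \<bar>m - m'\<bar>) \<le> 3 * max ?D \<bar>t - t'\<bar>"
    by (intro max.boundedI)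
  then show
    "mdist (asterisk X x0) (cylinder_to_asterisk ?p u) (cylinder_to_asterisk ?p v)
      \<le> 3 * mdist (p_cylinder X ?p) u v + 1"
    by (simp add: uv m_def m'_def cylinder_to_asterisk_def mdist_asterisk mdist_p_cylinder)
  \<comment> \<open>The cut-off \<open>t \<mapsto> min t (p x)\<close> moves each of the two points down by at most \<open>1\<close>.\<close>
  have "t - 1 \<le> m" "m \<le> t" "t' - 1 \<le> m'" "m' \<le> t'"
    using u v by (auto simp: m_def m'_def uv mspace_p_cylinder)
  then have "\<bar>t - t'\<bar> \<le> \<bar>m - m'\<bar> + 1"
    by linarith
  then have "max ?D \<bar>t - t'\<bar> \<le> max ?D (\<bar>(?p x - m) - (?p y - m')\<bar> + \<bar>m - m'\<bar>) + 1"
    by (intro max.boundedI) (auto simp: max_def)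
  also have "\<dots> \<le> 3 * max ?D (\<bar>(?p x - m) - (?p y - m')\<bar> + \<bar>m - m'\<bar>) + 1"
    by (intro add_right_mono max_le_three_times_max D)
  finally show
    "mdist (p_cylinder X ?p) u v
      \<le> 3 * mdist (asterisk X x0) (cylinder_to_asterisk ?p u) (cylinder_to_asterisk ?p v) + 1"
    by (simp add: uv m_def m'_def cylinder_to_asterisk_def mdist_asterisk mdist_p_cylinder)
qed (auto simp: cylinder_to_asterisk_def mspace_asterisk mspace_p_cylinder mdist_commute[of X x0])

section \<open>Transport of homotopies\<close>

lemma p_coarsely_homotopic_imp_coarsely_homotopic:
  assumes x0: "x0 \<in> mspace X" and hom: "p_coarsely_homotopic X Y (mdist X x0) \<alpha> \<beta>"
  shows "coarsely_homotopic X Y x0 \<alpha> \<beta>"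
proof -
  let ?p = "mdist X x0"
  obtain h where h: "coarse_map (p_cylinder X ?p) Y h"
    and h0: "\<And>x. x \<in> mspace X \<Longrightarrow> h (x, 0) = \<alpha> x"
    and h1: "\<And>x. x \<in> mspace X \<Longrightarrow> h (x, ?p x + 1) = \<beta> x"
    using hom by (auto simp: p_coarsely_homotopic_def p_cylinder_incl0_def p_cylinder_incl1_def)
  have hY: "h (x, t) \<in> mspace Y" if "x \<in> mspace X" "0 \<le> t" "t \<le> ?p x + 1" for x t
    using h that by (auto simp: coarse_map_def mspace_p_cylinder)
  let ?k = "h \<circ> asterisk_to_cylinder"
  have "coarse_map (asterisk X x0) Y ?k"
    using coarse_map_compose[OF coarse_asterisk_to_cylinder[OF x0] h] .
  moreover have "close_maps X Y (?k \<circ> asterisk_incl0 X x0) \<alpha>"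
    unfolding close_maps_iff
  proof (intro exI ballI)
    fix x assume x: "x \<in> mspace X"
    then have "\<alpha> x \<in> mspace Y"
      using h0[OF x] hY[OF x, of 0] by simp
    then show "mdist Y ((?k \<circ> asterisk_incl0 X x0) x) (\<alpha> x) \<le> 0"
      using h0[OF x]
      by (simp add: mdist_self asterisk_to_cylinder_def asterisk_incl0_def)
  qed
  moreover have "close_maps X Y (?k \<circ> asterisk_incl1 X x0) \<beta>"
  proof -
    have "close_maps X (p_cylinder X ?p) (\<lambda>x. (x, ?p x)) (p_cylinder_incl1 ?p)"
      unfolding close_maps_iff
      by (intro exI[of _ 1]) (simp add: mdist_self p_cylinder_incl1_def mdist_p_cylinder)
    then have "close_maps X Y (h \<circ> (\<lambda>x. (x, ?p x))) (h \<circ> p_cylinder_incl1 ?p)"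
      by (rule close_maps_compose_coarse[OF h])
        (auto simp: mspace_p_cylinder p_cylinder_incl1_def add_nonneg_nonneg)
    then show ?thesis
      using h1 by (simp add: close_maps_iff p_cylinder_incl1_def asterisk_to_cylinder_def
          asterisk_incl1_def mdist_commute[of X x0])
  qed
  ultimately show ?thesis
    unfolding coarsely_homotopic_def by blast
qed

lemma coarsely_homotopic_imp_p_coarsely_homotopic:
  assumes x0: "x0 \<in> mspace X"
    and \<alpha>: "\<alpha> \<in> mspace X \<rightarrow> mspace Y" and \<beta>: "\<beta> \<in> mspace X \<rightarrow> mspace Y"
    and hom: "coarsely_homotopic X Y x0 \<alpha> \<beta>"
  shows "p_coarsely_homotopic X Y (mdist X x0) \<alpha> \<beta>"
proof -
  let ?p = "mdist X x0"
  obtain h R S where h: "coarse_map (asterisk X x0) Y h"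
    and R: "\<And>x. x \<in> mspace X \<Longrightarrow> mdist Y (h (x, (?p x, 0))) (\<alpha> x) \<le> R"
    and S: "\<And>x. x \<in> mspace X \<Longrightarrow> mdist Y (h (x, (0, ?p x))) (\<beta> x) \<le> S"
    using hom
    unfolding coarsely_homotopic_def close_maps_iff comp_def asterisk_incl0_def asterisk_incl1_def
      mdist_commute[of X _ x0]
    by blast
  let ?f = "h \<circ> cylinder_to_asterisk ?p"
  have f: "coarse_map (p_cylinder X ?p) Y ?f"
    using coarse_map_compose[OF coarse_cylinder_to_asterisk[OF x0] h] .
  then have fY: "?f \<in> mspace (p_cylinder X ?p) \<rightarrow> mspace Y"
    by (simp add: coarse_map_def)
  define k where
    "k = (\<lambda>(x, t). if t = 0 then \<alpha> x else if t = ?p x + 1 then \<beta> x else ?f (x, t))"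
  have kY: "k \<in> mspace (p_cylinder X ?p) \<rightarrow> mspace Y"
  proof
    fix u assume u: "u \<in> mspace (p_cylinder X ?p)"
    obtain x t where xt: "u = (x, t)"
      by (metis surj_pair)
    have "x \<in> mspace X"
      using u by (simp add: xt mspace_p_cylinder)
    moreover have "?f u \<in> mspace Y"
      using fY u by blast
    ultimately show "k u \<in> mspace Y"
      using \<alpha> \<beta> by (auto simp: k_def xt)
  qed
  have "close_maps (p_cylinder X ?p) Y ?f k"
    unfolding close_maps_iff
  proof (intro exI ballI)
    fix u assume u: "u \<in> mspace (p_cylinder X ?p)"
    obtain x t where xt: "u = (x, t)"
      by (metis surj_pair)
    have x: "x \<in> mspace X"
      using u by (simp add: xt mspace_p_cylinder)
    consider "t = 0" | "t = ?p x + 1" "t \<noteq> 0" | "t \<noteq> 0" "t \<noteq> ?p x + 1"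
      by blast
    then show "mdist Y (?f u) (k u) \<le> max 0 (max R S)"
    proof cases
      case 1
      then show ?thesis
        using R[OF x] by (simp add: k_def xt cylinder_to_asterisk_def)
    next
      case 2
      then show ?thesis
        using S[OF x] by (simp add: k_def xt cylinder_to_asterisk_def)
    next
      case 3
      moreover have "mdist Y (?f u) (?f u) = 0"
        using fY u by (intro mdist_self) blast
      ultimately show ?thesis
        by (simp add: k_def xt)
    qed
  qed
  then have "coarse_map (p_cylinder X ?p) Y k"
    using coarse_map_if_close[OF f _ kY] by blast
  moreover have "?p x + 1 \<noteq> 0" for x
    using mdist_nonneg[of X x0 x] by linarith
  ultimately show ?thesis
    unfolding p_coarsely_homotopic_def
    by (intro exI[of _ k]) (auto simp: k_def p_cylinder_incl0_def p_cylinder_incl1_def)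
qed

theorem proposition26:
  fixes X :: "'a metric" and Y :: "'b metric"
    and x0 :: 'a and p :: "'a \<Rightarrow> real" and \<alpha> \<beta> :: "'a \<Rightarrow> 'b"
  assumes "x0 \<in> mspace X"
    and "p = (\<lambda>x. mdist X x0 x)"
    and "coarse_map X Y \<alpha>" and "coarse_map X Y \<beta>"
  shows "coarsely_homotopic X Y x0 \<alpha> \<beta> \<longleftrightarrow> p_coarsely_homotopic X Y p \<alpha> \<beta>"
proof -
  have "\<alpha> \<in> mspace X \<rightarrow> mspace Y" "\<beta> \<in> mspace X \<rightarrow> mspace Y"
    using assms(3,4) by (auto simp: coarse_map_def)
  then show ?thesis
    using coarsely_homotopic_imp_p_coarsely_homotopic[OF assms(1)]
      p_coarsely_homotopic_imp_coarsely_homotopic[OF assms(1)]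
    by (auto simp: assms(2))
qed

end
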